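(* Let $Q$ be a nontrivial cube root signature matrix of an equiangular $(n,k)$-frame with $2\le k<n\le 100$. Then $$(n,k)\in\{(9,6),(33,11),(36,21),(45,12),(51,34),(81,45),(96,76),(99,33)\}.$$
   Context: An $(n,k)$-frame is a family $\{f_1,\dots,f_n\}$ in $\mathbb{C}^k$ with $\sum_{j}|\langle x,f_j\rangle|^2=\|x\|^2$ for all $x\in\mathbb{C}^k$ (a Parseval frame). It is equiangular if all $f_i$ are non-zero and $|\langle f_i/\|f_i\|,f_j/\|f_j\|\rangle|$ is the same constant for all $i\ne j$. A Seidel matrix is a self-adjoint complex matrix with zero diagonal and off-diagonal entries of modulus one. An $n\times n$ Seidel matrix $Q$ is the signature matrix of an equiangular $(n,k)$-frame if there is an equiangular $(n,k)$-frame $\{f_1,\dots,f_n\}$ with $(\langle f_j,f_i\rangle)_{i,j}=\frac kn I_n+c_{n,k}Q$, where $c_{n,k}=\sqrt{\frac{k(n-k)}{n^2(n-1)}}$. A cube root Seidel matrix is a Seidel matrix all of whose off-diagonal entries are cube roots of unity; if it has exactly two distinct eigenvalues it is called a cube root signature matrix. Two Seidel matrices are switching equivalent if one is obtained from the other by conjugation with a diagonal unitary matrix and a permutation matrix. A Seidel matrix is in standard form if its first row and first column contain only $1$'s except on the diagonal; every Seidel matrix is switching equivalent to one in standard form (a standard form of it). It is trivial if it has a standard form with all off-diagonal entries equal to $1$, and nontrivial if its standard form has at least one off-diagonal entry not equal to $1$. *)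

theory Defs
  imports "Jordan_Normal_Form.Schur_Decomposition"
begin

(* Families f_1, ..., f_n are functions f on nat, restricted to the indices 0, ..., n - 1;
   C^k is carrier_vec k.  The inner product <x,y>, linear in x, is the library's x \<bullet>c y. *)

definition cvec_norm :: "complex vec \<Rightarrow> real" where
  "cvec_norm x = sqrt (Re (x \<bullet>c x))"

definition parseval_frame :: "nat \<Rightarrow> nat \<Rightarrow> (nat \<Rightarrow> complex vec) \<Rightarrow> bool" where
  "parseval_frame n k f \<longleftrightarrow>
     (\<forall>j<n. f j \<in> carrier_vec k) \<and>
     (\<forall>x\<in>carrier_vec k. (\<Sum>j<n. (cmod (x \<bullet>c f j))\<^sup>2) = (cvec_norm x)\<^sup>2)"

definition normalized :: "complex vec \<Rightarrow> complex vec" where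
  "normalized x = complex_of_real (1 / cvec_norm x) \<cdot>\<^sub>v x"

definition equiangular_frame :: "nat \<Rightarrow> nat \<Rightarrow> (nat \<Rightarrow> complex vec) \<Rightarrow> bool" where
  "equiangular_frame n k f \<longleftrightarrow>
     parseval_frame n k f \<and>
     (\<forall>i<n. f i \<noteq> 0\<^sub>v k) \<and>
     (\<exists>\<alpha>::real. \<forall>i<n. \<forall>j<n. i \<noteq> j \<longrightarrow>
        cmod (normalized (f i) \<bullet>c normalized (f j)) = \<alpha>)"

definition seidel_matrix :: "nat \<Rightarrow> complex mat \<Rightarrow> bool" where
  "seidel_matrix n Q \<longleftrightarrow>
     Q \<in> carrier_mat n n \<and> mat_adjoint Q = Q \<and>
     (\<forall>i<n. Q $$ (i, i) = 0) \<and>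
     (\<forall>i<n. \<forall>j<n. i \<noteq> j \<longrightarrow> cmod (Q $$ (i, j)) = 1)"

definition frame_const :: "nat \<Rightarrow> nat \<Rightarrow> real" where
  "frame_const n k =
     sqrt (real k * (real n - real k) / ((real n)\<^sup>2 * (real n - 1)))"

definition signature_matrix :: "nat \<Rightarrow> nat \<Rightarrow> complex mat \<Rightarrow> bool" where
  "signature_matrix n k Q \<longleftrightarrow>
     seidel_matrix n Q \<and>
     (\<exists>f. equiangular_frame n k f \<and>
          mat n n (\<lambda>(i, j). f j \<bullet>c f i) =
            (of_nat k / of_nat n) \<cdot>\<^sub>m 1\<^sub>m n + complex_of_real (frame_const n k) \<cdot>\<^sub>m Q)"

definition cube_root_seidel_matrix :: "nat \<Rightarrow> complex mat \<Rightarrow> bool" where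
  "cube_root_seidel_matrix n Q \<longleftrightarrow>
     seidel_matrix n Q \<and> (\<forall>i<n. \<forall>j<n. i \<noteq> j \<longrightarrow> (Q $$ (i, j)) ^ 3 = 1)"

definition cube_root_signature_matrix :: "nat \<Rightarrow> complex mat \<Rightarrow> bool" where
  "cube_root_signature_matrix n Q \<longleftrightarrow>
     cube_root_seidel_matrix n Q \<and> card {e. eigenvalue Q e} = 2"

definition diagonal_unitary_mat :: "nat \<Rightarrow> complex mat \<Rightarrow> bool" where
  "diagonal_unitary_mat n D \<longleftrightarrow>
     D \<in> carrier_mat n n \<and> diagonal_mat D \<and> D * mat_adjoint D = 1\<^sub>m n \<and> mat_adjoint D * D = 1\<^sub>m n"

definition permutation_mat :: "nat \<Rightarrow> complex mat \<Rightarrow> bool" where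
  "permutation_mat n P \<longleftrightarrow>
     (\<exists>p. p permutes {..<n} \<and> P = mat n n (\<lambda>(i, j). if i = p j then 1 else 0))"

(* The order of the two conjugations is immaterial: P * D = D' * P, where the diagonal
   unitary matrix D' is D with its diagonal entries permuted. *)
definition switching_equivalent :: "nat \<Rightarrow> complex mat \<Rightarrow> complex mat \<Rightarrow> bool" where
  "switching_equivalent n A B \<longleftrightarrow>
     (\<exists>D P. diagonal_unitary_mat n D \<and> permutation_mat n P \<and>
            B = P * (D * A * mat_adjoint D) * mat_adjoint P)"

definition standard_form :: "nat \<Rightarrow> complex mat \<Rightarrow> bool" where
  "standard_form n S \<longleftrightarrow>
     seidel_matrix n S \<and> (\<forall>j<n. j \<noteq> 0 \<longrightarrow> S $$ (0, j) = 1 \<and> S $$ (j, 0) = 1)"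

definition standard_form_of :: "nat \<Rightarrow> complex mat \<Rightarrow> complex mat \<Rightarrow> bool" where
  "standard_form_of n Q S \<longleftrightarrow> standard_form n S \<and> switching_equivalent n Q S"

(* Standard forms of Q need not be unique.  If one of them has all off-diagonal entries 1, so
   do all of them, hence the existential quantifier agrees with the universal one. *)
definition nontrivial_seidel :: "nat \<Rightarrow> complex mat \<Rightarrow> bool" where
  "nontrivial_seidel n Q \<longleftrightarrow>
     (\<exists>S. standard_form_of n Q S \<and> (\<exists>i<n. \<exists>j<n. i \<noteq> j \<and> S $$ (i, j) \<noteq> 1))"

end

(* The Gram matrix of a Parseval frame is a projection, so off the diagonal Q^2 = \<mu> Q with
   \<mu> = (1 - 2 k / n) / c.  Triple products of entries are invariant under switching, so some triple
   product Q(a,i) Q(i,j) Q(j,a) differs from 1; normalising row a by a diagonal conjugation gives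
   R with cube root entries and w = R(i,j) \<noteq> 1.  Counting the cube roots in rows i and j and in their
   product forces \<mu> to be an integer congruent to 1 mod 3, and 3 to divide n.  The eigenvalues
   p > 0 > -q of Q are then integers with n = p q + 1 and k (p + q) = n q, where p = 2 and q = 1
   mod 3; only finitely many pairs (p, q) satisfy p q < 100. *)
theory Submission
  imports Defs
begin

section \<open>Inner products and the Parseval identity\<close>

lemma cscalar_prod_smult_right:
  fixes x y :: "complex vec"
  assumes "x \<in> carrier_vec k" "y \<in> carrier_vec k"
  shows "x \<bullet>c (c \<cdot>\<^sub>v y) = cnj c * (x \<bullet>c y)"
  using assms by (simp add: conjugate_smult_vec)

lemma cscalar_prod_self:
  fixes x :: "complex vec"
  shows "x \<bullet>c x = complex_of_real ((cvec_norm x)\<^sup>2)"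
proof -
  have "x \<bullet>c x \<ge> 0" by (rule conjugate_square_ge_0_vec)
  hence "Re (x \<bullet>c x) \<ge> 0" "Im (x \<bullet>c x) = 0"
    by (simp_all add: less_eq_complex_def)
  thus ?thesis by (simp add: cvec_norm_def complex_eq_iff)
qed

lemma cnj_cscalar_prod:
  fixes x y :: "complex vec"
  assumes "x \<in> carrier_vec k" "y \<in> carrier_vec k"
  shows "cnj (x \<bullet>c y) = y \<bullet>c x"
  using assms conjugate_vec_sprod_comm[of y k x]
  by (simp add: conjugate_sprod_vec[of _ k] flip: conjugate_complex_def)

text \<open>Polarisation: the Parseval identity says that two sesquilinear forms agree on the
  diagonal, so they agree everywhere. For frame vectors \<open>x\<close> and \<open>y\<close> this
  is idempotence of the Gram matrix.\<close>

lemma parseval_frame_inner: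
  assumes frame: "parseval_frame n k f" and x: "x \<in> carrier_vec k" and y: "y \<in> carrier_vec k"
  shows "(\<Sum>l<n. (x \<bullet>c f l) * (f l \<bullet>c y)) = x \<bullet>c y"
proof -
  define S where "S x y = (\<Sum>l<n. (x \<bullet>c f l) * cnj (y \<bullet>c f l))" for x y
  have f: "f l \<in> carrier_vec k" if "l < n" for l
    using frame that by (simp add: parseval_frame_def)
  have diag: "S u u = u \<bullet>c u" if "u \<in> carrier_vec k" for u
  proof -
    have "S u u = complex_of_real (\<Sum>l<n. (cmod (u \<bullet>c f l))\<^sup>2)"
      by (simp only: S_def complex_norm_square of_real_sum)
    thus ?thesis
      using frame that by (simp only: parseval_frame_def cscalar_prod_self)
  qed
  have expand: "cnj c * S x y + c * S y x = cnj c * (x \<bullet>c y) + c * (y \<bullet>c x)" for c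
  proof -
    let ?u = "x + c \<cdot>\<^sub>v y"
    have cy: "c \<cdot>\<^sub>v y \<in> carrier_vec k" and u: "?u \<in> carrier_vec k" using x y by auto
    have lin: "?u \<bullet>c v = x \<bullet>c v + c * (y \<bullet>c v)" if "v \<in> carrier_vec k" for v
      using x y cy that by (simp add: add_scalar_prod_distrib[of _ k])
    have "S ?u ?u = (\<Sum>l<n. (x \<bullet>c f l + c * (y \<bullet>c f l)) * cnj (x \<bullet>c f l + c * (y \<bullet>c f l)))"
      unfolding S_def by (intro sum.cong refl) (simp add: lin f)
    also have "\<dots> = S x x + cnj c * S x y + c * S y x + c * cnj c * S y y"
      unfolding S_def sum_distrib_left sum.distrib[symmetric]
      by (intro sum.cong refl) (simp add: algebra_simps)
    finally have S_u: "S ?u ?u = S x x + cnj c * S x y + c * S y x + c * cnj c * S y y" .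
    have "?u \<bullet>c ?u = x \<bullet>c ?u + c * (y \<bullet>c ?u)" using lin[OF u] .
    also have "x \<bullet>c ?u = x \<bullet>c x + cnj c * (x \<bullet>c y)"
      using x y cy
      by (simp add: conjugate_add_vec[of _ k] scalar_prod_add_distrib[of _ k] cscalar_prod_smult_right[of _ k])
    also have "y \<bullet>c ?u = y \<bullet>c x + cnj c * (y \<bullet>c y)"
      using x y cy
      by (simp add: conjugate_add_vec[of _ k] scalar_prod_add_distrib[of _ k] cscalar_prod_smult_right[of _ k])
    finally show ?thesis
      using S_u diag[OF u] diag[OF x] diag[OF y] by (simp add: algebra_simps)
  qed
  \<comment> \<open>The values \<open>c = 1\<close> and \<open>c = \<i>\<close> determine the sum
    and the difference of \<open>S x y\<close> and \<open>S y x\<close>.\<close>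
  have "S x y = x \<bullet>c y"
    using expand[of 1] expand[of \<i>] by (simp add: complex_eq_iff)
  moreover have "S x y = (\<Sum>l<n. (x \<bullet>c f l) * (f l \<bullet>c y))"
    unfolding S_def by (intro sum.cong refl) (simp add: cnj_cscalar_prod[OF y f])
  ultimately show ?thesis by simp
qed

section \<open>The quadratic equation of the signature matrix\<close>

lemma seidel_matrix_cnj:
  assumes "seidel_matrix n Q" "i < n" "j < n"
  shows "cnj (Q $$ (i, j)) = Q $$ (j, i)"
proof -
  have Q: "Q \<in> carrier_mat n n" "mat_adjoint Q = Q"
    using assms(1) by (auto simp: seidel_matrix_def)
  have "mat_adjoint Q $$ (j, i) = cnj (Q $$ (i, j))"
    using Q(1) assms(2,3) by (simp add: mat_adjoint_def mat_of_rows_def)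
  thus ?thesis by (simp add: Q(2))
qed

text \<open>Substituting \<open>(k/n) I + c Q\<close> into the idempotence of the Gram matrix and
  reading off-diagonal entries gives the last claim. The first two claims state the value of
  \<open>\<mu>\<close> without the square root in \<open>c\<close>: the squared equation loses the
  sign, which the inequality restores.\<close>

lemma signature_matrix_square:
  assumes sig: "signature_matrix n k Q" and k: "0 < k" "k < n"
  obtains \<mu> :: real where
    "\<mu>\<^sup>2 * (real k * (real n - real k)) = (real n - 2 * real k)\<^sup>2 * (real n - 1)"
    "0 \<le> \<mu> * (real n - 2 * real k)"
    "\<And>i j. \<lbrakk>i < n; j < n; i \<noteq> j\<rbrakk> \<Longrightarrow>
      (\<Sum>l<n. Q $$ (i, l) * Q $$ (l, j)) = complex_of_real \<mu> * Q $$ (i, j)"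
proof -
  from sig obtain f where Q: "seidel_matrix n Q" and "parseval_frame n k f"
    and G: "mat n n (\<lambda>(i, j). f j \<bullet>c f i) =
      (of_nat k / of_nat n) \<cdot>\<^sub>m 1\<^sub>m n + complex_of_real (frame_const n k) \<cdot>\<^sub>m Q"
    by (auto simp: signature_matrix_def equiangular_frame_def)
  define c where "c = frame_const n k"
  define t where "t = real k / real n"
  have Qc: "Q \<in> carrier_mat n n" and Q0: "\<And>i. i < n \<Longrightarrow> Q $$ (i, i) = 0"
    using Q by (auto simp: seidel_matrix_def)
  have n: "n > 1" using k by linarith
  have c_sq: "c\<^sup>2 = real k * (real n - real k) / ((real n)\<^sup>2 * (real n - 1))"
    unfolding c_def frame_const_def using k by (intro real_sqrt_pow2) simp
  have c_pos: "c > 0"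
    unfolding c_def frame_const_def using k n by simp
  have entry: "f j \<bullet>c f i = (if i = j then of_real t else 0) + of_real c * Q $$ (i, j)"
    if "i < n" "j < n" for i j
  proof -
    have "f j \<bullet>c f i = mat n n (\<lambda>(i, j). f j \<bullet>c f i) $$ (i, j)" using that by simp
    thus ?thesis unfolding G using that Qc by (simp add: t_def c_def)
  qed
  define \<mu> where "\<mu> = (1 - 2 * t) / c"
  have square: "(\<Sum>l<n. Q $$ (i, l) * Q $$ (l, j)) = complex_of_real \<mu> * Q $$ (i, j)"
    if ij: "i < n" "j < n" "i \<noteq> j" for i j
  proof -
    let ?T = "complex_of_real t" and ?C = "complex_of_real c"
    have "?C * Q $$ (i, j) = f j \<bullet>c f i" using entry[of i j] ij by simp
    also have "\<dots> = (\<Sum>l<n. (f j \<bullet>c f l) * (f l \<bullet>c f i))"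
      using parseval_frame_inner[OF \<open>parseval_frame n k f\<close>, of "f j" "f i"] ij
        \<open>parseval_frame n k f\<close> by (simp add: parseval_frame_def)
    \<comment> \<open>The scalar part of the Gram matrix contributes only at \<open>l = i\<close>
      and \<open>l = j\<close>, where the matching term in \<open>Q\<close> vanishes by the zero
      diagonal.\<close>
    also have "\<dots> = (\<Sum>l<n. (if l = i then ?T * ?C * Q $$ (i, j) else 0)
        + (if l = j then ?T * ?C * Q $$ (i, j) else 0) + ?C\<^sup>2 * (Q $$ (i, l) * Q $$ (l, j)))"
      using ij by (intro sum.cong refl) (auto simp: entry Q0 power2_eq_square)
    also have "\<dots> = 2 * ?T * ?C * Q $$ (i, j) + ?C\<^sup>2 * (\<Sum>l<n. Q $$ (i, l) * Q $$ (l, j))"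
      using ij by (simp add: sum.distrib sum_distrib_left)
    finally have "?C * (?C * (\<Sum>l<n. Q $$ (i, l) * Q $$ (l, j))) = ?C * ((1 - 2 * ?T) * Q $$ (i, j))"
      by (simp add: algebra_simps power2_eq_square)
    hence "?C * (\<Sum>l<n. Q $$ (i, l) * Q $$ (l, j)) = (1 - 2 * ?T) * Q $$ (i, j)"
      using c_pos by simp
    thus ?thesis using c_pos by (simp add: \<mu>_def field_simps)
  qed
  have \<mu>_eq: "\<mu> = (real n - 2 * real k) / (real n * c)"
    using n by (simp add: \<mu>_def t_def field_simps)
  have "\<mu>\<^sup>2 = (real n - 2 * real k)\<^sup>2 / ((real n)\<^sup>2 * c\<^sup>2)"
    by (simp add: \<mu>_eq power_divide power_mult_distrib)
  also have "(real n)\<^sup>2 * c\<^sup>2 = real k * (real n - real k) / (real n - 1)"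
    using n by (simp add: c_sq)
  finally have "\<mu>\<^sup>2 * (real k * (real n - real k)) = (real n - 2 * real k)\<^sup>2 * (real n - 1)"
    using k n by simp
  moreover have "0 \<le> \<mu> * (real n - 2 * real k)"
    using c_pos by (simp add: \<mu>_eq)
  ultimately show ?thesis using that square by blast
qed

section \<open>Switching and triple products\<close>

lemma mult_mat_entry:
  assumes "A \<in> carrier_mat n m" "B \<in> carrier_mat m l" "i < n" "j < l"
  shows "(A * B) $$ (i, j) = (\<Sum>h\<in>{0..<m}. A $$ (i, h) * B $$ (h, j))"
  using assms by (simp add: scalar_prod_def)

lemma diagonal_conjugation_entry:
  assumes D: "diagonal_unitary_mat n D" and A: "A \<in> carrier_mat n n" and ij: "i < n" "j < n"
  shows "(D * A * mat_adjoint D) $$ (i, j) = D $$ (i, i) * A $$ (i, j) * cnj (D $$ (j, j))"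
proof -
  have Dc: "D \<in> carrier_mat n n" and diag: "\<And>i j. \<lbrakk>i < n; j < n; i \<noteq> j\<rbrakk> \<Longrightarrow> D $$ (i, j) = 0"
    using D by (auto simp: diagonal_unitary_mat_def diagonal_mat_def)
  have adj: "mat_adjoint D \<in> carrier_mat n n"
    "\<And>i j. \<lbrakk>i < n; j < n\<rbrakk> \<Longrightarrow> mat_adjoint D $$ (i, j) = cnj (D $$ (j, i))"
    using Dc by (auto simp: mat_adjoint_def mat_of_rows_def)
  have DA: "(D * A) $$ (i, l) = D $$ (i, i) * A $$ (i, l)" if "l < n" for l
  proof -
    have "(D * A) $$ (i, l) = (\<Sum>m\<in>{0..<n}. D $$ (i, m) * A $$ (m, l))"
      by (rule mult_mat_entry[OF Dc A ij(1) that])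
    also have "\<dots> = (\<Sum>m\<in>{0..<n}. if m = i then D $$ (i, i) * A $$ (i, l) else 0)"
      using diag ij by (intro sum.cong refl) auto
    finally show ?thesis using ij by simp
  qed
  have "(D * A * mat_adjoint D) $$ (i, j)
      = (\<Sum>l\<in>{0..<n}. (D * A) $$ (i, l) * mat_adjoint D $$ (l, j))"
    by (rule mult_mat_entry[OF mult_carrier_mat[OF Dc A] adj(1) ij])
  also have "\<dots> = (\<Sum>l\<in>{0..<n}. if l = j then D $$ (i, i) * A $$ (i, j) * cnj (D $$ (j, j)) else 0)"
    using diag ij by (intro sum.cong refl) (auto simp: DA adj)
  finally show ?thesis using ij by simp
qed

text \<open>Column \<open>j\<close> of \<open>P\<close> has its 1 in row \<open>p j\<close>, so
  conjugation relabels indices by \<open>p\<close>.\<close>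

lemma permutation_conjugation_entry:
  assumes p: "p permutes {..<n}" and P: "P = mat n n (\<lambda>(i, j). if i = p j then 1 else 0)"
    and A: "A \<in> carrier_mat n n" and ij: "i < n" "j < n"
  shows "(P * A * mat_adjoint P) $$ (p i, p j) = (A $$ (i, j) :: complex)"
proof -
  have pn: "p i < n" if "i < n" for i using permutes_in_image[OF p, of i] that by simp
  have inj: "p i = p j \<longleftrightarrow> i = j" for i j using permutes_inj[OF p] by (auto dest: injD)
  have Pc: "P \<in> carrier_mat n n" by (simp add: P)
  have adj: "mat_adjoint P \<in> carrier_mat n n"
    "\<And>i j. \<lbrakk>i < n; j < n\<rbrakk> \<Longrightarrow> mat_adjoint P $$ (i, j) = cnj (P $$ (j, i))"
    using Pc by (auto simp: mat_adjoint_def mat_of_rows_def)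
  have Pp: "P $$ (p x, y) = (if x = y then 1 else 0)" if "x < n" "y < n" for x y
    using that pn by (simp add: P inj)
  have PA: "(P * A) $$ (p i, l) = A $$ (i, l)" if "l < n" for l
  proof -
    have "(P * A) $$ (p i, l) = (\<Sum>m\<in>{0..<n}. P $$ (p i, m) * A $$ (m, l))"
      by (rule mult_mat_entry[OF Pc A pn[OF ij(1)] that])
    also have "\<dots> = (\<Sum>m\<in>{0..<n}. if m = i then A $$ (i, l) else 0)"
      using ij by (intro sum.cong refl) (auto simp: Pp)
    finally show ?thesis using ij by simp
  qed
  have "(P * A * mat_adjoint P) $$ (p i, p j)
      = (\<Sum>l\<in>{0..<n}. (P * A) $$ (p i, l) * mat_adjoint P $$ (l, p j))"
    by (rule mult_mat_entry[OF mult_carrier_mat[OF Pc A] adj(1) pn[OF ij(1)] pn[OF ij(2)]])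
  also have "\<dots> = (\<Sum>l\<in>{0..<n}. if l = j then A $$ (i, j) else 0)"
    using ij pn by (intro sum.cong refl) (auto simp: PA adj Pp)
  finally show ?thesis using ij by simp
qed

text \<open>In a standard form the triple product through the index 0 is the single entry
  \<open>S $$ (i, j)\<close>. Going around a closed triangle, the diagonal unitary factors cancel
  and the permutation only renames the vertices, so \<open>Q\<close> has the same triple
  product.\<close>

lemma nontrivial_seidel_triple:
  assumes Q: "seidel_matrix n Q" and nontriv: "nontrivial_seidel n Q"
  obtains a i j where "a < n" "i < n" "j < n" "a \<noteq> i" "a \<noteq> j" "i \<noteq> j"
    "Q $$ (a, i) * Q $$ (i, j) * Q $$ (j, a) \<noteq> 1"
proof -
  have Qc: "Q \<in> carrier_mat n n" using Q by (simp add: seidel_matrix_def)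
  from nontriv obtain S i j D P where S: "standard_form n S" and ij: "i < n" "j < n" "i \<noteq> j"
    and Sij: "S $$ (i, j) \<noteq> 1" and D: "diagonal_unitary_mat n D" and P: "permutation_mat n P"
    and S_eq: "S = P * (D * Q * mat_adjoint D) * mat_adjoint P"
    by (auto simp: nontrivial_seidel_def standard_form_of_def switching_equivalent_def)
  from P obtain p where p: "p permutes {..<n}"
    and P_eq: "P = mat n n (\<lambda>(i, j). if i = p j then 1 else 0)"
    by (auto simp: permutation_mat_def)
  \<comment> \<open>Off the diagonal, the first row and column of a standard form consist of
    ones.\<close>
  have nz: "i \<noteq> 0" "j \<noteq> 0" using S Sij ij unfolding standard_form_def by metis+
  have n: "0 < n" using ij by simp
  define q where "q = inv_into UNIV p"
  have q: "q permutes {..<n}" unfolding q_def by (rule permutes_inv[OF p])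
  have qn: "q x < n" if "x < n" for x using permutes_in_image[OF q, of x] that by simp
  have q_inj: "q x = q y \<longleftrightarrow> x = y" for x y using permutes_inj[OF q] by (auto dest: injD)
  have pq: "p (q x) = x" for x unfolding q_def by (rule permutes_inverses(1)[OF p])
  have unit: "cnj (D $$ (x, x)) * D $$ (x, x) = 1" if "x < n" for x
  proof -
    have Dc: "D \<in> carrier_mat n n" using D by (simp add: diagonal_unitary_mat_def)
    have "(D * 1\<^sub>m n * mat_adjoint D) $$ (x, x) = 1"
      using D Dc that by (simp add: diagonal_unitary_mat_def)
    thus ?thesis
      using diagonal_conjugation_entry[OF D, of "1\<^sub>m n" x x] that by (simp add: mult.commute)
  qed
  have entry: "S $$ (x, y) = D $$ (q x, q x) * Q $$ (q x, q y) * cnj (D $$ (q y, q y))"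
    if xy: "x < n" "y < n" for x y
  proof -
    have Dc: "D \<in> carrier_mat n n" using D by (simp add: diagonal_unitary_mat_def)
    hence "D * Q * mat_adjoint D \<in> carrier_mat n n" using Qc by (auto simp: mat_adjoint_def)
    from permutation_conjugation_entry[OF p P_eq this qn[OF xy(1)] qn[OF xy(2)]]
    have "S $$ (x, y) = (D * Q * mat_adjoint D) $$ (q x, q y)" unfolding S_eq pq .
    thus ?thesis using diagonal_conjugation_entry[OF D Qc qn[OF xy(1)] qn[OF xy(2)]] by simp
  qed
  have "S $$ (0, i) * S $$ (i, j) * S $$ (j, 0)
    = (cnj (D $$ (q 0, q 0)) * D $$ (q 0, q 0)) * (cnj (D $$ (q i, q i)) * D $$ (q i, q i))
      * (cnj (D $$ (q j, q j)) * D $$ (q j, q j))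
      * (Q $$ (q 0, q i) * Q $$ (q i, q j) * Q $$ (q j, q 0))"
    using ij n by (simp add: entry)
  also have "\<dots> = Q $$ (q 0, q i) * Q $$ (q i, q j) * Q $$ (q j, q 0)"
    using unit qn ij n by simp
  finally have "Q $$ (q 0, q i) * Q $$ (q i, q j) * Q $$ (q j, q 0) = S $$ (i, j)"
    using S ij nz n by (simp add: standard_form_def)
  with Sij show ?thesis
    using that[of "q 0" "q i" "q j"] qn ij n nz by (auto simp: q_inj)
qed

section \<open>Sums of cube roots of unity\<close>

lemma primitive_cube_root:
  fixes w :: complex
  assumes "w ^ 3 = 1" "w \<noteq> 1"
  shows "w\<^sup>2 = - 1 - w" "Im w \<noteq> 0" "cnj w = w\<^sup>2"
proof -
  have "(w - 1) * (w\<^sup>2 + w + 1) = w ^ 3 - 1"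
    by (simp add: algebra_simps power2_eq_square power3_eq_cube)
  hence "w\<^sup>2 + w + 1 = 0" using assms by simp
  thus sq: "w\<^sup>2 = - 1 - w" by (simp add: eq_diff_eq eq_neg_iff_add_eq_0 add.assoc add.commute)
  have re: "(Re w)\<^sup>2 - (Im w)\<^sup>2 = - 1 - Re w" and im: "2 * Re w * Im w = - Im w"
    using arg_cong[OF sq, of Re] arg_cong[OF sq, of Im] by (simp_all add: power2_eq_square mult.commute)
  show nz: "Im w \<noteq> 0"
  proof
    \<comment> \<open>For real \<open>w\<close>, completing the square in
      \<open>w^2 + w + 1 = 0\<close> is contradictory.\<close>
    assume "Im w = 0"
    with re have "(Re w + 1 / 2)\<^sup>2 + 3 / 4 = 0" by (simp add: power2_eq_square algebra_simps)
    moreover have "(Re w + 1 / 2)\<^sup>2 \<ge> 0" by simp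
    ultimately show False by linarith
  qed
  have "Im w * (2 * Re w + 1) = 0" using im by (simp add: algebra_simps)
  hence "2 * Re w + 1 = 0" using nz unfolding mult_eq_0_iff by simp
  thus "cnj w = w\<^sup>2" by (simp add: sq complex_eq_iff)
qed

lemma cube_root_cases:
  fixes w z :: complex
  assumes "w ^ 3 = 1" "w \<noteq> 1" "z ^ 3 = 1"
  shows "z = 1 \<or> z = w \<or> z = w\<^sup>2"
proof -
  have "(z - 1) * (z - w) * (z - w\<^sup>2) = z ^ 3 - z\<^sup>2 * (1 + w + w\<^sup>2) + z * (w + w\<^sup>2 + w ^ 3) - w ^ 3"
    by (simp add: algebra_simps power2_eq_square power3_eq_cube)
  also have "\<dots> = 0" using assms primitive_cube_root(1)[OF assms(1,2)] by simp
  finally show ?thesis by simp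
qed

text \<open>Replacing \<open>w^2\<close> by \<open>- 1 - w\<close> writes the sum in terms of 1 and
  \<open>w\<close>, which are independent over the reals as \<open>w\<close> is not real;
  coefficients can be compared. Since \<open>x\<close> and \<open>y\<close> are only assumed real,
  the lemma also yields their integrality.\<close>

lemma cube_root_sum_counts:
  fixes w :: complex and z :: "'a \<Rightarrow> complex" and x y :: real
  assumes w: "w ^ 3 = 1" "w \<noteq> 1" and z: "\<And>l. l \<in> L \<Longrightarrow> z l ^ 3 = 1"
    and sum: "(\<Sum>l\<in>L. z l) = of_real x + of_real y * w"
  defines "N \<equiv> \<lambda>v. \<Sum>l\<in>L. of_bool (z l = v) :: int"
  shows "x = of_int (N 1 - N (w\<^sup>2))" "y = of_int (N w - N (w\<^sup>2))"
    "int (card L) = N 1 + N w + N (w\<^sup>2)"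
proof -
  note prim = primitive_cube_root[OF w]
  have dist: "w\<^sup>2 \<noteq> 1" "w\<^sup>2 \<noteq> w"
    using prim(2) unfolding prim(1) by (auto simp: complex_eq_iff)
  have cases: "z l = 1 \<or> z l = w \<or> z l = w\<^sup>2" if "l \<in> L" for l
    using cube_root_cases[OF w z[OF that]] .
  have "int (card L) = (\<Sum>l\<in>L. 1)" by simp
  \<comment> \<open>Exactly one of the three indicators is 1, the cube roots being distinct.\<close>
  also have "\<dots> = (\<Sum>l\<in>L. of_bool (z l = 1) + of_bool (z l = w) + of_bool (z l = w\<^sup>2))"
    using cases dist w(2) by (intro sum.cong refl) fastforce
  finally show "int (card L) = N 1 + N w + N (w\<^sup>2)" by (simp only: N_def sum.distrib)
  have "(\<Sum>l\<in>L. z l) = (\<Sum>l\<in>L. of_int (of_bool (z l = 1)) + of_int (of_bool (z l = w)) * w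
      + of_int (of_bool (z l = w\<^sup>2)) * w\<^sup>2)"
    using cases dist w(2) by (intro sum.cong refl) fastforce
  also have "\<dots> = of_int (N 1) + of_int (N w) * w + of_int (N (w\<^sup>2)) * w\<^sup>2"
    by (simp only: N_def sum.distrib sum_distrib_right of_int_sum)
  also have "\<dots> = of_int (N 1 - N (w\<^sup>2)) + of_int (N w - N (w\<^sup>2)) * w"
    by (simp add: prim(1) algebra_simps)
  finally have eq: "of_real x + of_real y * w
      = (of_int (N 1 - N (w\<^sup>2)) + of_int (N w - N (w\<^sup>2)) * w :: complex)"
    using sum by simp
  from arg_cong[OF this, of Im] show y: "y = of_int (N w - N (w\<^sup>2))"
    using prim(2) by simp
  from arg_cong[OF eq, of Re] show "x = of_int (N 1 - N (w\<^sup>2))"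
    unfolding y by simp
qed

section \<open>Congruences modulo 3\<close>

text \<open>The ones in row and column \<open>a\<close> turn the square equation into row sums. Rows
  \<open>i\<close> and \<open>j\<close> and their product, restricted to the columns in
  \<open>L\<close>, then give three sums of cube roots; comparing their counts yields the
  integrality and both congruences.\<close>

lemma normalized_cube_root_square_mod_3:
  fixes R :: "nat \<Rightarrow> nat \<Rightarrow> complex" and \<mu> :: real
  assumes diag: "\<And>x. x < n \<Longrightarrow> R x x = 0"
    and cube: "\<And>x y. \<lbrakk>x < n; y < n; x \<noteq> y\<rbrakk> \<Longrightarrow> R x y ^ 3 = 1"
    and herm: "\<And>x y. \<lbrakk>x < n; y < n\<rbrakk> \<Longrightarrow> cnj (R x y) = R y x"
    and square: "\<And>x y. \<lbrakk>x < n; y < n; x \<noteq> y\<rbrakk> \<Longrightarrow> (\<Sum>l<n. R x l * R l y) = of_real \<mu> * R x y"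
    and norm: "\<And>l. \<lbrakk>l < n; l \<noteq> a\<rbrakk> \<Longrightarrow> R a l = 1"
    and a: "a < n" "a \<noteq> i" "a \<noteq> j" and ij: "i < n" "j < n" "i \<noteq> j" and nontriv: "R i j \<noteq> 1"
  obtains m :: int where "\<mu> = of_int m" "m mod 3 = 1" "n mod 3 = 0"
proof -
  define w where "w = R i j"
  define v where "v = w\<^sup>2"
  define L where "L = {..<n} - {i, j}"
  have w: "w ^ 3 = 1" "w \<noteq> 1" using cube ij nontriv by (auto simp: w_def)
  note prim = primitive_cube_root[OF w]
  have v: "v = - 1 - w" "cnj w = v" using prim by (auto simp: v_def)
  have dist: "w \<noteq> 1" "1 \<noteq> w" "v \<noteq> 1" "1 \<noteq> v" "v \<noteq> w" "w \<noteq> v"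
    using prim(2) w(2) unfolding v(1) by (auto simp: complex_eq_iff)
  have mult: "w * w = v" "w * v = 1" "v * w = 1" "v * v = w"
    using w(1) by (simp_all add: v_def power2_eq_square power3_eq_cube mult.assoc)
  have cnj_v: "cnj v = w" using v(2) by (metis complex_cnj_cnj)
  have norm': "R l a = 1" if "l < n" "l \<noteq> a" for l
    using herm[of a l] norm[of l] a that by simp
  have row: "(\<Sum>l<n. R x l) = of_real (\<mu> + 1)" if x: "x < n" "x \<noteq> a" for x
  proof -
    \<comment> \<open>The extra 1 at \<open>l = a\<close> replaces \<open>R x a = 1\<close>, which
      the factor \<open>R a a = 0\<close> removes.\<close>
    have "(\<Sum>l<n. R x l) = (\<Sum>l<n. R x l * R l a + (if l = a then 1 else 0))"
      using norm' diag x a by (intro sum.cong refl) auto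
    also have "\<dots> = of_real \<mu> * R x a + 1" using square[of x a] x a by (simp add: sum.distrib)
    finally show ?thesis using norm' x by simp
  qed
  have split: "(\<Sum>l<n. g l) = g i + g j + (\<Sum>l\<in>L. g l)" for g :: "nat \<Rightarrow> complex"
  proof -
    have "{..<n} = insert i (insert j L)" "finite L" "i \<notin> L" "j \<notin> L"
      using ij by (auto simp: L_def)
    thus ?thesis using ij(3) by (simp add: add.assoc)
  qed
  have Rji: "R j i = v" using herm[of i j] ij v(2) by (simp add: w_def)
  \<comment> \<open>Row \<open>i\<close> loses 0 and \<open>w\<close>, row \<open>j\<close> loses
    \<open>v = - 1 - w\<close> and 0; both terms removed from the product sum vanish.\<close>
  have sum_i: "(\<Sum>l\<in>L. R i l) = of_real (\<mu> + 1) + of_real (- 1) * w"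
    using row[of i] split[of "R i"] diag ij a by (simp add: w_def algebra_simps)
  have sum_j: "(\<Sum>l\<in>L. R j l) = of_real (\<mu> + 2) + of_real 1 * w"
    using row[of j] split[of "R j"] diag ij a Rji v(1) by (simp add: algebra_simps)
  have sum_ij: "(\<Sum>l\<in>L. R i l * R l j) = of_real 0 + of_real \<mu> * w"
    using square[of i j] split[of "\<lambda>l. R i l * R l j"] diag ij by (simp add: w_def)
  have L: "l < n" "l \<noteq> i" "l \<noteq> j" if "l \<in> L" for l using that by (auto simp: L_def)
  have cubes: "R i l ^ 3 = 1" "R j l ^ 3 = 1" "(R i l * R l j) ^ 3 = 1" if "l \<in> L" for l
    using cube L[OF that] ij by (auto simp: power_mult_distrib)
  define N where "N g c = (\<Sum>l\<in>L. of_bool (g l = c) :: int)" for g :: "nat \<Rightarrow> complex" and c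
  have Ni: "\<mu> + 1 = of_int (N (R i) 1 - N (R i) v)" "- 1 = real_of_int (N (R i) w - N (R i) v)"
      "int (card L) = N (R i) 1 + N (R i) w + N (R i) v"
    using cube_root_sum_counts[OF w cubes(1) sum_i] by (simp_all only: N_def v_def)
  have Nj: "\<mu> + 2 = of_int (N (R j) 1 - N (R j) v)"
    using cube_root_sum_counts(1)[OF w cubes(2) sum_j] by (simp only: N_def v_def)
  have Nij: "0 = real_of_int (N (\<lambda>l. R i l * R l j) 1 - N (\<lambda>l. R i l * R l j) v)"
    using cube_root_sum_counts(1)[OF w cubes(3) sum_ij] by (simp only: N_def v_def)
  define m where "m = N (R i) 1 - N (R i) v - 1"
  have m: "\<mu> = of_int m" using Ni(1) by (simp add: m_def)
  have Ni2: "N (R i) w = N (R i) v - 1" using Ni(2) by linarith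
  have Nj2: "N (R j) 1 - N (R j) v = m + 2" using Nj m by linarith
  have "card L = n - 2" using ij by (simp add: L_def)
  moreover have "n \<ge> 2" using ij by linarith
  ultimately have n: "int n = m + 2 + 3 * N (R i) v" using Ni(3) Ni2 m_def by simp
  \<comment> \<open>Write \<open>R i l = w\<^sup>r\<close> and \<open>R j l = w\<^sup>s\<close> with \<open>r, s\<close> in the affine plane of order 3.  The points \<open>(0, 0)\<close> and
    \<open>(1, 2)\<close> lie on a common line \<open>r + s = 0\<close>, so the difference of the numbers of \<open>l\<close> at these points
    is determined by the other three parallel classes, whose counts are known.\<close>
  define M where "M = (\<Sum>l\<in>L. of_bool (R i l = 1 \<and> R j l = 1) - of_bool (R i l = w \<and> R j l = v) :: int)"
  have pointwise: "of_bool (R i l = 1) - of_bool (R i l = w) + of_bool (R j l = 1) - of_bool (R j l = v)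
        + of_bool (R i l * R l j = 1) - of_bool (R i l * R l j = v)
      = (3 * (of_bool (R i l = 1 \<and> R j l = 1) - of_bool (R i l = w \<and> R j l = v)) :: int)"
    if l: "l \<in> L" for l
  proof -
    have "R l j = cnj (R j l)" using herm[of j l] L[OF l] ij by simp
    moreover have "R i l = 1 \<or> R i l = w \<or> R i l = v" "R j l = 1 \<or> R j l = w \<or> R j l = v"
      using cube_root_cases[OF w cubes(1)[OF l]] cube_root_cases[OF w cubes(2)[OF l]]
      by (simp_all add: v_def)
    \<comment> \<open>The product is \<open>w^(r - s)\<close>. Of the nine points, (0, 0) lies on
      the three lines counted positively and (1, 2) on the three counted negatively; at the other
      seven the signs cancel.\<close>
    ultimately show ?thesis using dist mult v(2) cnj_v by (elim disjE) simp_all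
  qed
  have "N (R i) 1 - N (R i) w + N (R j) 1 - N (R j) v
      + N (\<lambda>l. R i l * R l j) 1 - N (\<lambda>l. R i l * R l j) v = 3 * M"
    unfolding N_def M_def sum_distrib_left
    by (simp only: sum.distrib[symmetric] sum_subtractf[symmetric])
      (intro sum.cong refl pointwise)
  \<comment> \<open>The differences for row \<open>i\<close> and for row \<open>j\<close> are each
    \<open>m + 2\<close>; that of the product is 0.\<close>
  hence "2 * (m + 2) = 3 * M" using Ni2 Nj2 Nij by (simp add: m_def)
  hence "m mod 3 = 1" by presburger
  moreover from this have "n mod 3 = 0" using n by presburger
  ultimately show ?thesis by (rule that[OF m])
qed

section \<open>Integral eigenvalues and the finite search\<close>

text \<open>The eigenvalues \<open>p\<close> and \<open>- q\<close> are the roots of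
  \<open>x^2 - \<mu> x - (n - 1)\<close>. The equation makes the discriminant the square of an
  integer \<open>s = p + q\<close>, so \<open>p\<close> and \<open>q\<close> are integers, and they
  determine \<open>n\<close> and \<open>k\<close>.\<close>

lemma admissible_parameters:
  fixes n k \<mu> :: int
  assumes k: "2 \<le> k" "k < n" and n: "n \<le> 100" "n mod 3 = 0" and \<mu>: "\<mu> mod 3 = 1"
    and eq: "\<mu>\<^sup>2 * (k * (n - k)) = (n - 2 * k)\<^sup>2 * (n - 1)"
    and sgn: "0 \<le> \<mu> * (n - 2 * k)"
  shows "(n, k) \<in> {(9, 6), (33, 11), (36, 21), (45, 12), (51, 34), (81, 45), (96, 76), (99, 33)}"
proof -
  define d where "d = n - 2 * k"
  have "\<mu> \<noteq> 0" using \<mu> by auto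
  have "d \<noteq> 0"
    using eq k \<open>\<mu> \<noteq> 0\<close> by (auto simp: d_def)
  \<comment> \<open>This is the squared form of \<open>n * \<mu> = d * s\<close>, where
    \<open>s\<close> is a square root of the discriminant; it shows that \<open>s\<close> is an
    integer.\<close>
  have sq: "d\<^sup>2 * (\<mu>\<^sup>2 + 4 * (n - 1)) = (n * \<mu>)\<^sup>2"
  proof -
    have "n\<^sup>2 = d\<^sup>2 + 4 * (k * (n - k))" by (simp add: d_def power2_eq_square algebra_simps)
    hence "(n * \<mu>)\<^sup>2 = d\<^sup>2 * \<mu>\<^sup>2 + 4 * (\<mu>\<^sup>2 * (k * (n - k)))"
      by (simp only: power_mult_distrib) (simp add: algebra_simps)
    also have "\<dots> = d\<^sup>2 * \<mu>\<^sup>2 + 4 * (d\<^sup>2 * (n - 1))" by (simp only: eq d_def)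
    also have "\<dots> = d\<^sup>2 * (\<mu>\<^sup>2 + 4 * (n - 1))" by (simp add: algebra_simps)
    finally show ?thesis by simp
  qed
  hence "d\<^sup>2 dvd (n * \<mu>)\<^sup>2" by (metis dvd_triv_left)
  hence "d dvd n * \<mu>" by simp
  then obtain s where s: "n * \<mu> = d * s" by auto
  have s_sq: "s\<^sup>2 = \<mu>\<^sup>2 + 4 * (n - 1)"
    using sq \<open>d \<noteq> 0\<close> by (simp add: s power_mult_distrib)
  \<comment> \<open>The sign hypothesis selects the nonnegative root \<open>s\<close>.\<close>
  have "d\<^sup>2 * s = n * (\<mu> * d)" using s by (simp add: power2_eq_square algebra_simps)
  hence "0 \<le> d\<^sup>2 * s" using sgn k by (simp add: d_def)
  hence "0 \<le> s" using \<open>d \<noteq> 0\<close> by (simp add: zero_le_mult_iff)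
  have "even (s\<^sup>2) \<longleftrightarrow> even (\<mu>\<^sup>2)" unfolding s_sq by simp
  hence "even (s - \<mu>)" by simp
  then obtain q where q: "s = \<mu> + 2 * q" by (metis add.commute diff_eq_eq evenE)
  define p where "p = \<mu> + q"
  have pq: "n = p * q + 1"
    using s_sq by (simp add: q p_def power2_eq_square algebra_simps)
  \<comment> \<open>Since \<open>n > 1\<close>, \<open>s\<close> exceeds both \<open>\<mu>\<close>
    and \<open>- \<mu>\<close>; here \<open>2 * q = s - \<mu>\<close> and
    \<open>2 * p = s + \<mu>\<close>.\<close>
  have "\<not> \<bar>s\<bar> \<le> \<bar>\<mu>\<bar>" unfolding abs_le_square_iff using s_sq k by simp
  hence pos: "0 < p" "0 < q" using \<open>0 \<le> s\<close> by (auto simp: q p_def)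
  have kpq: "q * (p * q + 1) = k * (p + q)"
    using s unfolding d_def pq[symmetric] by (simp add: q p_def algebra_simps)
  \<comment> \<open>Modulo 3, \<open>p - q\<close> is 1 and \<open>p * q\<close> is -1.\<close>
  have "q mod 3 = 1 \<and> p mod 3 = 2"
  proof -
    have "(p * q) mod 3 = 2" using n pq by presburger
    moreover have "(p * q) mod 3 = (p mod 3) * (q mod 3) mod 3" by (simp add: mod_mult_eq)
    moreover have "p mod 3 = 0 \<and> q mod 3 = 2 \<or> p mod 3 = 1 \<and> q mod 3 = 0 \<or> p mod 3 = 2 \<and> q mod 3 = 1"
      using \<mu> unfolding p_def by presburger
    ultimately show ?thesis by auto
  qed
  \<comment> \<open>The value \<open>q = 1\<close> would force \<open>k = 1\<close>; hence
    \<open>q\<close> is at least 4, and \<open>p * q < 100\<close> bounds both factors.\<close>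
  moreover have "q \<noteq> 1"
  proof
    assume "q = 1"
    with kpq have "1 * (p + 1) = k * (p + 1)" by simp
    thus False using k(1) pos unfolding mult_cancel_right by auto
  qed
  ultimately have q4: "q mod 3 = 1" "4 \<le> q" and p2: "p mod 3 = 2" "2 \<le> p" using pos by presburger+
  have le: "p * q \<le> 99" using pq n by simp
  have "p * 4 \<le> p * q" "2 * q \<le> p * q" using pos p2 q4 by (simp_all add: mult_mono)
  hence "p \<le> 24" "q \<le> 49" using le by linarith+
  have p_cases: "p \<in> {2, 5, 8, 11, 14, 17, 20, 23}" using p2 \<open>p \<le> 24\<close> by simp presburger
  have q_cases: "q \<in> {4, 7, 10, 13, 16, 19, 22, 25, 28, 31, 34, 37, 40, 43, 46, 49}"
    using q4 \<open>q \<le> 49\<close> by simp presburger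
  have dvd: "(p + q) dvd q * (p * q + 1)" unfolding kpq by simp
  have k_div: "k = q * (p * q + 1) div (p + q)" unfolding kpq using pos by simp
  \<comment> \<open>Every remaining pair either violates the bound or the divisibility, or yields a
    listed \<open>(n, k)\<close>.\<close>
  from p_cases q_cases show ?thesis using le dvd unfolding k_div pq
    by (elim insertE emptyE; simp)
qed

section \<open>Normalising a row and passing to the integers\<close>

theorem mainTheorem5:
  fixes n k :: nat and Q :: "complex mat"
  assumes "2 \<le> k" and "k < n" and "n \<le> 100"
    and "cube_root_signature_matrix n Q"
    and "nontrivial_seidel n Q"
    and "signature_matrix n k Q"
  shows "(n, k) \<in> {(9, 6), (33, 11), (36, 21), (45, 12), (51, 34), (81, 45), (96, 76), (99, 33)}"
proof -
  have Q: "seidel_matrix n Q"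
    and cube: "\<And>i j. \<lbrakk>i < n; j < n; i \<noteq> j\<rbrakk> \<Longrightarrow> Q $$ (i, j) ^ 3 = 1"
    using assms(4) by (auto simp: cube_root_signature_matrix_def cube_root_seidel_matrix_def)
  have diag: "\<And>i. i < n \<Longrightarrow> Q $$ (i, i) = 0"
    and modulus: "\<And>i j. \<lbrakk>i < n; j < n; i \<noteq> j\<rbrakk> \<Longrightarrow> cmod (Q $$ (i, j)) = 1"
    using Q by (auto simp: seidel_matrix_def)
  have "0 < k" using assms(1) by simp
  from signature_matrix_square[OF assms(6) this assms(2)] obtain \<mu> :: real where
    \<mu>: "\<mu>\<^sup>2 * (real k * (real n - real k)) = (real n - 2 * real k)\<^sup>2 * (real n - 1)"
      "0 \<le> \<mu> * (real n - 2 * real k)"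
    and square: "\<And>i j. \<lbrakk>i < n; j < n; i \<noteq> j\<rbrakk> \<Longrightarrow>
      (\<Sum>l<n. Q $$ (i, l) * Q $$ (l, j)) = complex_of_real \<mu> * Q $$ (i, j)"
    by blast
  from nontrivial_seidel_triple[OF Q assms(5)] obtain a i j where
    a: "a < n" "a \<noteq> i" "a \<noteq> j" and ij: "i < n" "j < n" "i \<noteq> j"
    and triple: "Q $$ (a, i) * Q $$ (i, j) * Q $$ (j, a) \<noteq> 1"
    by metis
  \<comment> \<open>Conjugation by the diagonal matrix of \<open>u\<close> makes row
    \<open>a\<close> all ones off the diagonal. As \<open>u\<close> has cube root entries, so does
    \<open>R\<close> off the diagonal, and \<open>R i j\<close> becomes the triple product at
    \<open>a\<close>, \<open>i\<close>, \<open>j\<close>.\<close>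
  define u where "u x = (if x = a then 1 else Q $$ (a, x))" for x
  define R where "R x y = u x * Q $$ (x, y) * cnj (u y)" for x y
  have u: "u x ^ 3 = 1" "u x * cnj (u x) = 1" "cnj (u x) * u x = 1" if "x < n" for x
    using cube[of a x] modulus[of a x] a(1) that
    by (auto simp: u_def mult.commute[of "cnj _"] complex_norm_square[symmetric])
  obtain m :: int where m: "\<mu> = of_int m" "m mod 3 = 1" "n mod 3 = 0"
  proof (rule normalized_cube_root_square_mod_3[of n R \<mu> a i j])
    show "R x x = 0" if "x < n" for x using diag that by (simp add: R_def)
    show "R x y ^ 3 = 1" if "x < n" "y < n" "x \<noteq> y" for x y
      using cube[of x y] u(1)[of x] u(1)[of y] that
      by (simp add: R_def power_mult_distrib flip: complex_cnj_power)
    show "cnj (R x y) = R y x" if "x < n" "y < n" for x y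
      using seidel_matrix_cnj[OF Q that] by (simp add: R_def)
    show "(\<Sum>l<n. R x l * R l y) = of_real \<mu> * R x y" if "x < n" "y < n" "x \<noteq> y" for x y
    proof -
      have "(\<Sum>l<n. R x l * R l y)
          = (\<Sum>l<n. (cnj (u l) * u l) * (u x * cnj (u y) * (Q $$ (x, l) * Q $$ (l, y))))"
        by (intro sum.cong refl) (simp add: R_def)
      also have "\<dots> = u x * cnj (u y) * (\<Sum>l<n. Q $$ (x, l) * Q $$ (l, y))"
        unfolding sum_distrib_left by (intro sum.cong refl) (simp add: u(3))
      finally show ?thesis using square[OF that] by (simp add: R_def)
    qed
    show "R a l = 1" if "l < n" "l \<noteq> a" for l
      using u(2)[of l] that by (simp add: R_def u_def)
    show "R i j \<noteq> 1"
      using triple a ij seidel_matrix_cnj[OF Q a(1) ij(2)] by (simp add: R_def u_def)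
  qed (use a ij in auto)
  \<comment> \<open>With \<open>\<mu>\<close> an integer, both relations hold over the
    integers.\<close>
  have "real_of_int (m\<^sup>2 * (int k * (int n - int k))) = of_int ((int n - 2 * int k)\<^sup>2 * (int n - 1))"
    using \<mu>(1) by (simp add: m(1))
  moreover have "real_of_int 0 \<le> of_int (m * (int n - 2 * int k))"
    using \<mu>(2) by (simp add: m(1))
  ultimately have "(int n, int k) \<in> {(9, 6), (33, 11), (36, 21), (45, 12), (51, 34), (81, 45), (96, 76), (99, 33)}"
    using assms(1-3) m(2,3)
    by (intro admissible_parameters[of "int k" "int n" m])
      (simp_all only: of_int_eq_iff of_int_le_iff, presburger+)
  thus ?thesis by auto
qed

end
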